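(* Assume the collision kernel satisfies $\sigma(g,\theta)\approx g$. Let $a^\mu$ be a space-like vector and $b^\mu$ an energy-momentum vector. Suppose $f\ge0$ and $f\in L^1_1(\mathbb{R}^3)$. Then $$\int_{\mathbb{R}^3}(p^0)^{1/2}\,Q^+(f,f)(p)\,\delta\big(a^\mu(p_\mu-b_\mu)\big)\,dp\le\frac{C}{\sqrt{a^\mu a_\mu}}\,\|f\|^2_{L^1_{1/2}},$$ where $C>0$ is a constant independent of $f$, $a^\mu$ and $b^\mu$.
   Context: Notation. For $p\in\mathbb{R}^3$ let $p^0=\sqrt{1+|p|^2}$ and $p^\mu=(p^0,p)$. The Lorentz product of 4-vectors is $a^\mu b_\mu=-a^0b^0+\sum_{i=1}^3a^ib^i$. A 4-vector $a^\mu=(a^0,a)$ is space-like if $a^\mu a_\mu>0$. An energy-momentum vector is a 4-vector $b^\mu$ with $b^\mu b_\mu=-1$ and $b^0>0$. Put $s=s(p^\mu,q^\mu)=2(-p^\mu q_\mu+1)$ and $g=g(p^\mu,q^\mu)=\sqrt{(p^\mu-q^\mu)(p_\mu-q_\mu)}=\sqrt{|p-q|^2-(p^0-q^0)^2}$, so $s=g^2+4$. The Møller velocity is $v_\phi=\frac{g\sqrt s}{p^0q^0}$. For $\omega\in\mathbb{S}^2$ the post-collisional momenta are $$p'=\tfrac{p+q}{2}+\tfrac g2\Big(\omega+(\gamma-1)(p+q)\tfrac{(p+q)\cdot\omega}{|p+q|^2}\Big),\quad q'=\tfrac{p+q}{2}-\tfrac g2\Big(\omega+(\gamma-1)(p+q)\tfrac{(p+q)\cdot\omega}{|p+q|^2}\Big),$$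 with $\gamma=(p^0+q^0)/\sqrt s$; then $p^\mu+q^\mu=p'^\mu+q'^\mu$. The scattering angle is given by $\cos\theta=(p^\mu-q^\mu)(p'_\mu-q'_\mu)/g^2$. The collision kernel $\sigma(g,\theta)\ge0$ is measurable, and $\sigma\approx g$ means $c^{-1}g\le\sigma(g,\theta)\le cg$ for some constant $c>0$. The gain operator is $$Q^+(f,h)(p)=\int_{\mathbb{R}^3\times\mathbb{S}^2}v_\phi\,\sigma(g,\theta)f(p')h(q')\,d\omega\,dq .$$ Norms: $\|f\|_{L^1_k}=\int_{\mathbb{R}^3}(p^0)^k|f(p)|\,dp$. The Dirac delta has its standard meaning $\int_{\mathbb{R}^3}F(p)\delta(G(p))\,dp=\int_{G(p)=0}\frac{F(p)}{|\nabla G(p)|}\,d\pi_p$, with $d\pi_p$ the surface measure on $\{G=0\}$; the integral against $Q^+(f,f)$ is understood by testing $Q^+(f,f)$ with the nonnegative measure $\varphi(p)=(p^0)^{1/2}\delta(a^\mu(p_\mu-b_\mu))$, i.e. as $$\int_{\mathbb{R}^3}Q^+(f,f)\,\varphi(p)\,dp=\int_{\mathbb{R}^3}\int_{\mathbb{R}^3}\int_{\mathbb{S}^2}v_\phi\,\sigma(g,\theta)f(p)f(q)\,\varphi(p')\,d\omega\,dq\,dp .$$ *)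

theory Defs
  imports "HOL-Analysis.Analysis"
begin

definition hausdorff1_pre :: "real \<Rightarrow> 'a::metric_space set \<Rightarrow> ennreal" where
  "hausdorff1_pre \<delta> A =
     (INF U \<in> {U :: nat \<Rightarrow> 'a set. A \<subseteq> (\<Union>n. U n) \<and> (\<forall>n. bounded (U n) \<and> diameter (U n) \<le> \<delta>)}.
        \<Sum>n. ennreal (diameter (U n)))"

definition hausdorff1_outer :: "'a::metric_space set \<Rightarrow> ennreal" where
  "hausdorff1_outer A = (SUP \<delta> \<in> {0<..}. hausdorff1_pre \<delta> A)"

text \<open>
  The length measure (one-dimensional Hausdorff measure, normalised so that a segment has its
  length as measure). It is the surface measure on the curves of the unit sphere that occur below.
  \<^term>\<open>measure_of\<close> would collapse to the zero measure if \<^term>\<open>hausdorff1_outer\<close> were not countably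
  additive on the Borel sets; \<open>hausdorff1_measure_space\<close> and \<open>emeasure_hausdorff1\<close> show that it is.
\<close>
definition hausdorff1 :: "'a::metric_space measure" where
  "hausdorff1 = measure_of UNIV (sets borel) hausdorff1_outer"

lemma metric_outer_measure_borel:
  fixes f :: "'a::metric_space set \<Rightarrow> ennreal"
  assumes oms: "outer_measure_space UNIV f"
    and met: "\<And>A B e. e > 0 \<Longrightarrow> (\<And>x y. x \<in> A \<Longrightarrow> y \<in> B \<Longrightarrow> e \<le> dist x y) \<Longrightarrow> f A + f B \<le> f (A \<union> B)"
  shows "measure_space UNIV (sets borel) f"
proof -
  interpret P: sigma_algebra "UNIV :: 'a set" UNIV
    using sigma_algebra_Pow[of "UNIV :: 'a set"] by simp
  have pos: "f {} = 0" and inc: "increasing UNIV f" and csa: "countably_subadditive UNIV f"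
    using oms by (auto simp: outer_measure_space_def positive_def)
  have mono: "A \<subseteq> B \<Longrightarrow> f A \<le> f B" for A B
    using inc by (auto simp: increasing_def)
  have sub: "f (A \<union> B) \<le> f A + f B" for A B
    using P.countably_subadditive_subadditive[OF _ csa] pos
    by (auto simp: positive_def subadditive_def intro: order_trans)
       (metis Un_Diff_cancel Diff_disjoint Diff_subset add_left_mono mono order_trans)
  have csub: "f (\<Union>i. A i) \<le> (\<Sum>i. f (A i))" for A :: "nat \<Rightarrow> 'a set"
  proof -
    have "f (\<Union>i. disjointed A i) \<le> (\<Sum>i. f (disjointed A i))"
      using csa disjoint_family_disjointed by (auto simp: countably_subadditive_def)
    also have "\<dots> \<le> (\<Sum>i. f (A i))"
      by (intro suminf_le mono disjointed_subset) auto
    finally show ?thesis by (simp add: UN_disjointed_eq)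
  qed
  let ?L = "lambda_system UNIV UNIV f"
  have closed_L: "C \<in> ?L" if "closed C" for C
  proof (cases "C = {}")
    case True then show ?thesis by (simp add: lambda_system_def pos)
  next
    case False
    have "f (A \<inter> C) + f (A - C) \<le> f A" for A
    proof (cases "f A = \<infinity>")
      case False
      define r where "r k = 1 / (real k + 1)" for k :: nat
      have r: "r j < r i" if "i < j" for i j
        using that by (simp add: r_def frac_less2)
      have rle: "r j \<le> r i" if "i \<le> j" for i j
        using that by (simp add: r_def frac_le)
      have rp: "r k > 0" for k by (simp add: r_def)
      define d where "d x = infdist x C" for x
      have dl: "d x - d y \<le> dist x y" for x y
        unfolding d_def using infdist_triangle[of x C y] by linarith
      define An where "An n = {x\<in>A. r n \<le> d x}" for n
      define R where "R k = {x\<in>A. r (Suc k) \<le> d x \<and> d x < r k}" for k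
      have split: "f (\<Union>k<n. R (2*k+e)) \<ge> (\<Sum>k<n. f (R (2*k+e)))" for n e
      proof (induction n)
        case (Suc n)
        have "(\<Sum>k<Suc n. f (R (2*k+e))) \<le> f (\<Union>k<n. R (2*k+e)) + f (R (2*n+e))"
          using Suc by (simp add: add_right_mono)
        also have "\<dots> \<le> f ((\<Union>k<n. R (2*k+e)) \<union> R (2*n+e))"
        proof (cases n)
          case (Suc m)
          have rr: "0 < r (2*m+e+1) - r (2*n+e)" using r[of "2*m+e+1" "2*n+e"] Suc by simp
          show ?thesis
          proof (rule met[OF rr])
            fix x y assume x: "x \<in> (\<Union>k<n. R (2*k+e))" and y: "y \<in> R (2*n+e)"
            then obtain k where k: "k < n" "x \<in> R (2*k+e)" by auto
            then have "r (2*m+e+1) \<le> r (Suc (2*k+e))" using Suc by (intro rle) auto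
            also have "\<dots> \<le> d x" using k by (simp add: R_def)
            finally show "r (2*m+e+1) - r (2*n+e) \<le> dist x y"
              using dl[of x y] y by (simp add: R_def)
          qed
        qed (simp add: pos)
        also have "\<dots> = f (\<Union>k<Suc n. R (2*k+e))"
          by (simp add: lessThan_Suc Un_commute)
        finally show ?case .
      qed (simp add: pos)
      have split': "(\<Sum>k<n. f (R (2*k+e))) \<le> f A" for n e
        by (rule order_trans[OF split mono]) (auto simp: R_def)
      have part: "(\<Sum>k<2*n. f (R k)) = (\<Sum>k<n. f (R (2*k+0))) + (\<Sum>k<n. f (R (2*k+1)))" for n
        by (induction n) (auto simp: algebra_simps)
      have fin: "(\<Sum>k. f (R k)) \<le> f A + f A"
      proof (rule suminf_le_const[OF summableI])
        fix n
        have "(\<Sum>k<n. f (R k)) \<le> (\<Sum>k<2*n. f (R k))" by (intro sum_mono2) auto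
        also have "\<dots> \<le> f A + f A" unfolding part by (intro add_mono split')
        finally show "(\<Sum>k<n. f (R k)) \<le> f A + f A" .
      qed
      then have nt: "(\<Sum>k. f (R k)) < top"
        using False by (simp add: top_unique less_top[symmetric]) (metis ennreal_add_eq_top top_unique)
      show ?thesis
      proof (rule ennreal_le_epsilon)
        fix e :: real assume e: "0 < e"
        obtain n where n: "(\<Sum>k. f (R k)) < (\<Sum>k<n. f (R k)) + ennreal e"
        proof -
          have "(\<lambda>n. (\<Sum>k<n. f (R k)) + ennreal e) \<longlonglongrightarrow> (\<Sum>k. f (R k)) + ennreal e"
            by (intro tendsto_add tendsto_const summable_LIMSEQ summableI)
          moreover have "(\<Sum>k. f (R k)) < (\<Sum>k. f (R k)) + ennreal e"
            using nt e by simp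
          ultimately have "eventually (\<lambda>n. (\<Sum>k. f (R k)) < (\<Sum>k<n. f (R k)) + ennreal e) sequentially"
            by (rule order_tendstoD)
          then show ?thesis using that by (auto simp: eventually_sequentially)
        qed
        have tail: "(\<Sum>k. f (R (k+n))) \<le> ennreal e"
        proof -
          have "(\<Sum>k<n. f (R k)) + (\<Sum>k. f (R (k+n))) = (\<Sum>k. f (R k))"
            using suminf_offset[of "\<lambda>k. f (R k)" n] by (simp add: summableI add.commute)
          then have "(\<Sum>k<n. f (R k)) + (\<Sum>k. f (R (k+n))) \<le> (\<Sum>k<n. f (R k)) + ennreal e"
            using n by simp
          moreover have "(\<Sum>k<n. f (R k)) \<le> (\<Sum>k. f (R k))"
            by (intro sum_le_suminf summableI) auto
          then have "(\<Sum>k<n. f (R k)) < top" using nt by (rule order_le_less_trans)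
          then have "(\<Sum>k<n. f (R k)) \<noteq> top" by (simp only: less_top)
          ultimately show ?thesis by (simp add: ennreal_add_left_cancel_le)
        qed
        have cov: "A - C \<subseteq> An n \<union> (\<Union>k. R (k+n))"
        proof
          fix x assume x: "x \<in> A - C"
          then have dx: "d x > 0"
            using \<open>closed C\<close> \<open>C \<noteq> {}\<close> unfolding d_def
            by (metis DiffD2 in_closed_iff_infdist_zero infdist_nonneg order_le_less)
          show "x \<in> An n \<union> (\<Union>k. R (k+n))"
          proof (cases "r n \<le> d x")
            case True then show ?thesis using x by (simp add: An_def)
          next
            case F: False
            obtain m where "inverse (real (Suc m)) < d x" using reals_Archimedean[OF dx] by blast
            then have ex: "\<exists>m. r m \<le> d x" by (intro exI[of _ m]) (simp add: r_def inverse_eq_divide add.commute)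
            define m where "m = (LEAST m. r m \<le> d x)"
            have m: "r m \<le> d x" unfolding m_def using ex by (rule LeastI_ex)
            have "n < m" using m F rle[of m n] by (meson leI order_trans)
            then obtain j where j: "m = Suc (j + n)" by (metis less_imp_Suc_add add.commute)
            have "\<not> r (j+n) \<le> d x" using not_less_Least[of "j+n" "\<lambda>m. r m \<le> d x"] j m_def by simp
            then have "x \<in> R (j+n)" using x m j by (simp add: R_def)
            then show ?thesis by blast
          qed
        qed
        have "f (A \<inter> C) + f (A - C) \<le> f (A \<inter> C) + (f (An n) + (\<Sum>k. f (R (k+n))))"
          using mono[OF cov] sub[of "An n" "\<Union>k. R (k+n)"] csub[of "\<lambda>k. R (k+n)"]
          by (intro add_left_mono) (meson add_left_mono order_trans)
        also have "\<dots> \<le> (f (A \<inter> C) + f (An n)) + ennreal e"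
          using tail by (simp add: add.assoc add_left_mono)
        also have "f (A \<inter> C) + f (An n) \<le> f ((A \<inter> C) \<union> An n)"
        proof (rule met[OF rp[of n]])
          fix x y assume "x \<in> A \<inter> C" "y \<in> An n"
          then show "r n \<le> dist x y"
            using dl[of y x] by (simp add: An_def d_def dist_commute)
        qed
        also have "\<dots> \<le> f A" by (intro mono) (auto simp: An_def)
        finally show "f (A \<inter> C) + f (A - C) \<le> f A + ennreal e" by (simp add: add_right_mono)
      qed
    qed (simp add: top_unique)
    moreover have "f A \<le> f (A \<inter> C) + f (A - C)" for A
      using sub[of "A \<inter> C" "A - C"] by (simp add: Int_Diff_Un)
    ultimately show ?thesis by (auto simp: P.lambda_system_eq intro: antisym)
  qed
  have ms: "measure_space UNIV ?L f" by (rule P.caratheodory_lemma[OF oms])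
  then interpret L: sigma_algebra UNIV ?L by (simp add: measure_space_def)
  have "sets (borel :: 'a measure) = sigma_sets UNIV (Collect closed)"
    by (simp add: borel_eq_closed)
  also have "\<dots> \<subseteq> ?L" using closed_L by (intro L.sigma_sets_subset) auto
  finally show ?thesis
    using ms by (intro measure_down[OF ms]) (auto intro: sets.sigma_algebra_axioms[of borel, simplified])
qed

lemma hausdorff1_pre_bound:
  assumes "\<And>n. bounded (U n)" "\<And>n. diameter (U n) \<le> \<delta>" "A \<subseteq> (\<Union>n. U n)"
  shows "hausdorff1_pre \<delta> A \<le> (\<Sum>n. ennreal (diameter (U n)))"
  unfolding hausdorff1_pre_def using assms by (intro INF_lower) auto

lemma hausdorff1_outer_space: "outer_measure_space UNIV (hausdorff1_outer :: 'a::metric_space set \<Rightarrow> ennreal)"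
proof -
  have "hausdorff1_pre \<delta> ({}::'a set) = 0" if "\<delta> > 0" for \<delta>
    using hausdorff1_pre_bound[of "\<lambda>_. {}" \<delta> "{}"] that by simp
  then have 1: "hausdorff1_outer ({}::'a set) = 0"
    by (auto simp: hausdorff1_outer_def bot_ennreal[symmetric] intro!: SUP_eqI)
  have pm: "hausdorff1_pre \<delta> A \<le> hausdorff1_pre \<delta> B" if "A \<subseteq> B" for \<delta> and A B :: "'a set"
    unfolding hausdorff1_pre_def using that by (intro INF_superset_mono) auto
  then have 2: "hausdorff1_outer A \<le> hausdorff1_outer B" if "A \<subseteq> B" for A B :: "'a set"
    unfolding hausdorff1_outer_def using that by (intro SUP_mono) auto
  have pre: "hausdorff1_pre \<delta> (\<Union>i. A i) \<le> (\<Sum>i. hausdorff1_pre \<delta> (A i))"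
    for \<delta> and A :: "nat \<Rightarrow> 'a set"
  proof (rule ennreal_le_epsilon)
    fix e :: real assume e: "0 < e" and fin: "(\<Sum>i. hausdorff1_pre \<delta> (A i)) < top"
    have "\<exists>U. A i \<subseteq> (\<Union>n. U n) \<and> (\<forall>n. bounded (U n) \<and> diameter (U n) \<le> \<delta>) \<and>
        (\<Sum>n. ennreal (diameter (U n))) \<le> hausdorff1_pre \<delta> (A i) + ennreal (e * (1/2)^Suc i)" for i
    proof -
      have "hausdorff1_pre \<delta> (A i) \<le> (\<Sum>i. hausdorff1_pre \<delta> (A i))"
        using sum_le_suminf[of "\<lambda>i. hausdorff1_pre \<delta> (A i)" "{i}"] by (simp add: summableI)
      then have "hausdorff1_pre \<delta> (A i) < top" using fin by (rule order_le_less_trans)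
      then have "hausdorff1_pre \<delta> (A i) < hausdorff1_pre \<delta> (A i) + ennreal (e * (1/2)^Suc i)"
        using e by simp
      then show ?thesis
        unfolding hausdorff1_pre_def[of _ "A i"] INF_less_iff
        by (auto simp del: ennreal_plus intro: less_imp_le)
    qed
    then obtain U where U: "\<And>i. A i \<subseteq> (\<Union>n. U i n)" "\<And>i n. bounded (U i n)" "\<And>i n. diameter (U i n) \<le> \<delta>"
      "\<And>i. (\<Sum>n. ennreal (diameter (U i n))) \<le> hausdorff1_pre \<delta> (A i) + ennreal (e * (1/2)^Suc i)"
      by metis
    define V where "V = (\<lambda>(i,n). U i n) \<circ> prod_decode"
    have sV: "(\<Sum>n. ennreal (diameter (V n))) = (\<Sum>i. \<Sum>n. ennreal (diameter (U i n)))"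
      using suminf_ennreal_2dimen[of "\<lambda>i. \<Sum>n. ennreal (diameter (U i n))" "\<lambda>p. ennreal (diameter (U (fst p) (snd p)))"]
      by (simp add: V_def comp_def split_beta)
    have "hausdorff1_pre \<delta> (\<Union>i. A i) \<le> (\<Sum>n. ennreal (diameter (V n)))"
    proof (rule hausdorff1_pre_bound)
      show "(\<Union>i. A i) \<subseteq> (\<Union>n. V n)"
      proof
        fix x assume "x \<in> (\<Union>i. A i)"
        then obtain i n where "x \<in> U i n" using U(1) by blast
        then have "x \<in> V (prod_encode (i,n))" by (simp add: V_def)
        then show "x \<in> (\<Union>n. V n)" by blast
      qed
    qed (auto simp: V_def split_beta U)
    also have "\<dots> \<le> (\<Sum>i. hausdorff1_pre \<delta> (A i) + ennreal (e * (1/2)^Suc i))"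
      unfolding sV by (intro suminf_le U(4)) auto
    also have "\<dots> = (\<Sum>i. hausdorff1_pre \<delta> (A i)) + (\<Sum>i. ennreal (e * (1/2)^Suc i))"
      by (simp add: suminf_add[symmetric] summableI del: power_Suc)
    also have "(\<Sum>i. ennreal (e * (1/2)^Suc i)) = ennreal e"
      using e sums_mult[OF power_half_series, of e] by (intro suminf_ennreal_eq) auto
    finally show "hausdorff1_pre \<delta> (\<Union>i. A i) \<le> (\<Sum>i. hausdorff1_pre \<delta> (A i)) + ennreal e" .
  qed
  have 3: "hausdorff1_outer (\<Union>i. A i) \<le> (\<Sum>i. hausdorff1_outer (A i))" for A :: "nat \<Rightarrow> 'a set"
    unfolding hausdorff1_outer_def[of "\<Union>i. A i"]
  proof (rule SUP_least)
    fix \<delta> :: real assume d: "\<delta> \<in> {0<..}"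
    have "(\<Sum>i. hausdorff1_pre \<delta> (A i)) \<le> (\<Sum>i. hausdorff1_outer (A i))"
      unfolding hausdorff1_outer_def using d by (intro suminf_le SUP_upper) auto
    then show "hausdorff1_pre \<delta> (\<Union>i. A i) \<le> (\<Sum>i. hausdorff1_outer (A i))"
      using pre[of \<delta> A] by (rule order_trans[rotated])
  qed
  show ?thesis
    using 1 2 3 by (auto simp: outer_measure_space_def positive_def increasing_def countably_subadditive_def)
qed

lemma hausdorff1_measure_space: "measure_space UNIV (sets borel) (hausdorff1_outer :: 'a::metric_space set \<Rightarrow> ennreal)"
proof (rule metric_outer_measure_borel[OF hausdorff1_outer_space])
  fix A B :: "'a set" and e :: real
  assume e: "e > 0" and sep: "\<And>x y. x \<in> A \<Longrightarrow> y \<in> B \<Longrightarrow> e \<le> dist x y"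
  have anti: "hausdorff1_pre d2 S \<le> hausdorff1_pre d1 S" if "d1 \<le> d2" for d1 d2 and S :: "'a set"
    unfolding hausdorff1_pre_def using that by (intro INF_superset_mono) (auto intro: order_trans)
  have key: "hausdorff1_pre \<delta> A + hausdorff1_pre \<delta> B \<le> hausdorff1_pre \<delta> (A \<union> B)" if "\<delta> < e" for \<delta>
    unfolding hausdorff1_pre_def[of \<delta> "A \<union> B"]
  proof (rule INF_greatest, clarsimp)
    fix U :: "nat \<Rightarrow> 'a set"
    assume cA: "A \<subseteq> \<Union> (range U)" and cB: "B \<subseteq> \<Union> (range U)"
      and U: "\<forall>n. bounded (U n) \<and> diameter (U n) \<le> \<delta>"
    define V where "V n = (if U n \<inter> A = {} then {} else U n)" for n
    define W where "W n = (if U n \<inter> A = {} then U n else {})" for n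
    have \<delta>0: "0 \<le> \<delta>" using U diameter_ge_0 order_trans by blast
    have no: "U n \<inter> B = {}" if nA: "U n \<inter> A \<noteq> {}" for n
    proof (rule ccontr)
      assume "U n \<inter> B \<noteq> {}"
      then obtain x y where "x \<in> U n" "x \<in> A" "y \<in> U n" "y \<in> B" using nA by blast
      then have "e \<le> diameter (U n)"
        using sep diameter_bounded_bound[of "U n" x y] U by (meson order_trans)
      then show False using U \<open>\<delta> < e\<close> by (meson linorder_not_le order_trans)
    qed
    have "hausdorff1_pre \<delta> A \<le> (\<Sum>n. ennreal (diameter (V n)))"
      using U cA \<delta>0 by (intro hausdorff1_pre_bound) (auto simp: V_def, blast)
    moreover have "hausdorff1_pre \<delta> B \<le> (\<Sum>n. ennreal (diameter (W n)))"
      using U cB \<delta>0 no by (intro hausdorff1_pre_bound) (auto simp: W_def, blast)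
    moreover have "(\<Sum>n. ennreal (diameter (V n))) + (\<Sum>n. ennreal (diameter (W n))) =
        (\<Sum>n. ennreal (diameter (U n)))"
      by (subst suminf_add) (auto simp: V_def W_def summableI intro!: suminf_cong)
    ultimately show "hausdorff1_pre \<delta> A + hausdorff1_pre \<delta> B \<le> (\<Sum>n. ennreal (diameter (U n)))"
      by (metis add_mono)
  qed
  have "hausdorff1_pre d1 A + hausdorff1_pre d2 B \<le> hausdorff1_outer (A \<union> B)" if "d1 > 0" "d2 > 0" for d1 d2
  proof -
    define d where "d = min (min d1 d2) (e/2)"
    have "hausdorff1_pre d1 A + hausdorff1_pre d2 B \<le> hausdorff1_pre d A + hausdorff1_pre d B"
      by (intro add_mono anti) (auto simp: d_def)
    also have "\<dots> \<le> hausdorff1_pre d (A \<union> B)" using e by (intro key) (auto simp: d_def)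
    also have "\<dots> \<le> hausdorff1_outer (A \<union> B)"
      unfolding hausdorff1_outer_def using that e by (intro SUP_upper) (auto simp: d_def)
    finally show ?thesis .
  qed
  then have "hausdorff1_pre d1 A + hausdorff1_outer B \<le> hausdorff1_outer (A \<union> B)" if "d1 > 0" for d1
    unfolding hausdorff1_outer_def[of B] using that
    by (subst ennreal_SUP_add_right) (auto intro!: SUP_least)
  then show "hausdorff1_outer A + hausdorff1_outer B \<le> hausdorff1_outer (A \<union> B)"
    unfolding hausdorff1_outer_def[of A]
    by (subst ennreal_SUP_add_left[symmetric]) (auto intro!: SUP_least)
qed

lemma sets_hausdorff1 [simp]: "sets hausdorff1 = sets borel"
  using sets.sigma_sets_eq[of "borel"] by (simp add: hausdorff1_def)
lemma space_hausdorff1 [simp]: "space hausdorff1 = UNIV"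
  by (simp add: hausdorff1_def)

lemma emeasure_hausdorff1: "A \<in> sets borel \<Longrightarrow> emeasure hausdorff1 A = hausdorff1_outer A"
  using hausdorff1_measure_space
  by (intro emeasure_measure_of[OF hausdorff1_def]) (auto simp: measure_space_def)

type_synonym space3 = "real ^ 3"
type_synonym fourvec = "real \<times> (real ^ 3)"

definition lorentz :: "fourvec \<Rightarrow> fourvec \<Rightarrow> real" where
  "lorentz a b = - (fst a * fst b) + snd a \<bullet> snd b"

definition space_like :: "fourvec \<Rightarrow> bool" where
  "space_like a \<longleftrightarrow> lorentz a a > 0"

definition energy_momentum :: "fourvec \<Rightarrow> bool" where
  "energy_momentum b \<longleftrightarrow> lorentz b b = -1 \<and> fst b > 0"

definition en :: "space3 \<Rightarrow> real" where
  "en p = sqrt (1 + (norm p)\<^sup>2)"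

definition mom :: "space3 \<Rightarrow> fourvec" where
  "mom p = (en p, p)"

definition s_inv :: "space3 \<Rightarrow> space3 \<Rightarrow> real" where
  "s_inv p q = 2 * (- lorentz (mom p) (mom q) + 1)"

definition g_rel :: "space3 \<Rightarrow> space3 \<Rightarrow> real" where
  "g_rel p q = sqrt (lorentz (mom p - mom q) (mom p - mom q))"

definition v_moller :: "space3 \<Rightarrow> space3 \<Rightarrow> real" where
  "v_moller p q = g_rel p q * sqrt (s_inv p q) / (en p * en q)"

definition gamma_cm :: "space3 \<Rightarrow> space3 \<Rightarrow> real" where
  "gamma_cm p q = (en p + en q) / sqrt (s_inv p q)"

text \<open>
  For \<open>p + q = 0\<close> the term with the factor \<open>\<gamma> - 1\<close> is read as \<open>0\<close> (there \<open>\<gamma> = 1\<close>), which is what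
  division by zero gives here.
\<close>
definition scatter_dir :: "space3 \<Rightarrow> space3 \<Rightarrow> space3 \<Rightarrow> space3" where
  "scatter_dir p q \<omega> =
     \<omega> + ((gamma_cm p q - 1) * (((p + q) \<bullet> \<omega>) / (norm (p + q))\<^sup>2)) *\<^sub>R (p + q)"

definition p_post :: "space3 \<Rightarrow> space3 \<Rightarrow> space3 \<Rightarrow> space3" where
  "p_post p q \<omega> = (1/2) *\<^sub>R (p + q) + (g_rel p q / 2) *\<^sub>R scatter_dir p q \<omega>"

definition q_post :: "space3 \<Rightarrow> space3 \<Rightarrow> space3 \<Rightarrow> space3" where
  "q_post p q \<omega> = (1/2) *\<^sub>R (p + q) - (g_rel p q / 2) *\<^sub>R scatter_dir p q \<omega>"

definition scatter_angle :: "space3 \<Rightarrow> space3 \<Rightarrow> space3 \<Rightarrow> real" where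
  "scatter_angle p q \<omega> =
     arccos (lorentz (mom p - mom q) (mom (p_post p q \<omega>) - mom (q_post p q \<omega>)) / (g_rel p q)\<^sup>2)"

definition collision_kernel :: "(real \<Rightarrow> real \<Rightarrow> real) \<Rightarrow> bool" where
  "collision_kernel \<sigma> \<longleftrightarrow>
     (\<lambda>(g, \<theta>). \<sigma> g \<theta>) \<in> borel_measurable (lebesgue_on ({0..} \<times> {0..pi})) \<and>
     (\<forall>g\<ge>0. \<forall>\<theta>\<in>{0..pi}. 0 \<le> \<sigma> g \<theta>)"

definition kernel_approx_g :: "(real \<Rightarrow> real \<Rightarrow> real) \<Rightarrow> bool" where
  "kernel_approx_g \<sigma> \<longleftrightarrow>
     (\<exists>c>0. \<forall>g\<ge>0. \<forall>\<theta>\<in>{0..pi}. inverse c * g \<le> \<sigma> g \<theta> \<and> \<sigma> g \<theta> \<le> c * g)"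

definition in_L1 :: "real \<Rightarrow> (space3 \<Rightarrow> real) \<Rightarrow> bool" where
  "in_L1 k f \<longleftrightarrow> f \<in> borel_measurable lebesgue \<and> integrable lebesgue (\<lambda>p. en p powr k * \<bar>f p\<bar>)"

definition L1_norm :: "real \<Rightarrow> (space3 \<Rightarrow> real) \<Rightarrow> real" where
  "L1_norm k f = (LINT p|lebesgue. en p powr k * \<bar>f p\<bar>)"

definition gradient :: "('a::real_inner \<Rightarrow> real) \<Rightarrow> 'a \<Rightarrow> 'a" where
  "gradient F x = (THE D. gderiv F x D)"

lemma gradient_eqI:
  assumes "gderiv F x D"
  shows "gradient F x = D"
  unfolding gradient_def
proof (rule the_equality)
  fix D' assume "gderiv F x D'"
  then have "(\<lambda>h. h \<bullet> D') = (\<lambda>h. h \<bullet> D)"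
    using assms unfolding gderiv_def by (rule has_derivative_unique)
  then have "(D' - D) \<bullet> D' = (D' - D) \<bullet> D" by (rule fun_cong)
  then have "(D' - D) \<bullet> (D' - D) = 0" by (simp only: inner_diff_right diff_self)
  then show "D' = D" by simp
qed (rule assms)

definition sphere_gradient :: "(space3 \<Rightarrow> real) \<Rightarrow> space3 \<Rightarrow> space3" where
  "sphere_gradient H \<omega> = gradient H \<omega> - (gradient H \<omega> \<bullet> \<omega>) *\<^sub>R \<omega>"

text \<open>
  \<open>\<integral> F(\<omega>) \<delta>(H(\<omega>)) d\<omega>\<close> over the unit sphere: the standard formula
  \<open>\<integral>\<^bsub>{G = 0}\<^esub> F / |\<nabla>G| d\<pi>\<close> for the Dirac delta, with the gradient along the sphere (the tangential
  part of the gradient, for which only the values of \<open>H\<close> on the sphere matter) and the length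
  measure on the level curve. The quotient is taken in \<^typ>\<open>ennreal\<close>, so that a positive \<open>F\<close> over a
  vanishing gradient counts as infinite, not as the \<open>0\<close> of real division.
\<close>
definition sphere_delta :: "(space3 \<Rightarrow> real) \<Rightarrow> (space3 \<Rightarrow> real) \<Rightarrow> ennreal" where
  "sphere_delta F H =
     (\<integral>\<^sup>+\<omega>\<in>{\<omega> \<in> sphere 0 1. H \<omega> = 0}.
        (ennreal (F \<omega>) / ennreal (norm (sphere_gradient H \<omega>))) \<partial>hausdorff1)"

text \<open>
  \<open>\<integral> Q\<^sup>+(f,h)(p) w(p) \<delta>(G(p)) dp\<close>, i.e. the gain operator tested with the measure
  \<open>\<phi>(p) = w(p) \<delta>(G(p))\<close> in the weak form
  \<open>\<integral>\<integral>\<integral> v\<^sub>\<phi> \<sigma>(g,\<theta>) f(p) h(q) \<phi>(p') d\<omega> dq dp\<close>. For fixed \<open>p\<close> and \<open>q\<close>, \<open>\<phi>(p')\<close> carries the delta of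
  \<open>\<omega> \<mapsto> G(p'(\<omega>))\<close> into the integral over the sphere.
\<close>
definition gain_tested ::
  "(real \<Rightarrow> real \<Rightarrow> real) \<Rightarrow> (space3 \<Rightarrow> real) \<Rightarrow> (space3 \<Rightarrow> real) \<Rightarrow>
   (space3 \<Rightarrow> real) \<Rightarrow> (space3 \<Rightarrow> real) \<Rightarrow> ennreal" where
  "gain_tested \<sigma> f h w G =
     (\<integral>\<^sup>+p. \<integral>\<^sup>+q.
        sphere_delta
          (\<lambda>\<omega>. v_moller p q * \<sigma> (g_rel p q) (scatter_angle p q \<omega>) * f p * h q * w (p_post p q \<omega>))
          (\<lambda>\<omega>. G (p_post p q \<omega>))
      \<partial>lebesgue \<partial>lebesgue)"

end

theory Submission
  imports Defs
begin

text \<open>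
  On the unit sphere \<open>p'\<close> is the midpoint of \<open>p\<close> and \<open>q\<close> plus \<open>g/2\<close> times the boost of \<open>(0, \<omega>)\<close>,
  so the argument of the delta is an affine function \<open>\<alpha> + (g/2) (d \<bullet> \<omega>)\<close>, where \<open>d\<close> is the spatial part
  of \<open>a\<close> in the center-of-mass frame. Its zero set is a circle of radius \<open>r\<close> on which the tangential
  gradient has norm \<open>(g/2) |d| r\<close>; hence the mass of the delta is of order \<open>1/(g |d|)\<close>, and
  \<open>|d|\<^sup>2\<close> is at least the Lorentz square of \<open>a\<close>. The factor \<open>1/g\<close> is absorbed by \<open>\<sigma> \<le> c g\<close>, and
  \<open>v\<^sub>\<phi> \<le> 4\<close> together with \<open>p'\<^sup>0 \<le> p\<^sup>0 + q\<^sup>0 \<le> 2 p\<^sup>0 q\<^sup>0\<close> gives a pointwise bound by the product of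
  the two weighted densities.
\<close>

section \<open>Length of circles and the delta of an affine function on the sphere\<close>

text \<open>Cutting the interval into \<open>n\<close> equal pieces covers the curve by sets of
  diameter at most \<open>L * T / n\<close>. This drops below any \<open>\<delta>\<close> for large
  \<open>n\<close>, while the sum of the diameters stays at most \<open>L * T\<close>.\<close>

lemma hausdorff1_outer_lipschitz_image_le:
  fixes \<gamma> :: "real \<Rightarrow> 'a::metric_space"
  assumes "0 \<le> L" "0 < T"
    and lip: "\<And>x y. x \<in> {0..T} \<Longrightarrow> y \<in> {0..T} \<Longrightarrow> dist (\<gamma> x) (\<gamma> y) \<le> L * \<bar>x - y\<bar>"
  shows "hausdorff1_outer (\<gamma> ` {0..T}) \<le> ennreal (L * T)"
  unfolding hausdorff1_outer_def
proof (rule SUP_least)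
  fix \<delta> :: real assume "\<delta> \<in> {0<..}"
  then have \<delta>: "\<delta> > 0" by simp
  obtain n :: nat where n: "L * T / \<delta> < real n" using reals_Archimedean2 by blast
  have n0: "0 < real n" using n assms(1,2) \<delta> by (meson divide_nonneg_pos le_less_trans less_imp_le mult_nonneg_nonneg)
  define h where "h = T / n"
  \<comment> \<open>The cover must be an infinite sequence, so it is padded with empty sets of
    diameter 0.\<close>
  define U where "U k = (if k < n then \<gamma> ` ({real k * h .. real (Suc k) * h} \<inter> {0..T}) else {})" for k
  have h0: "h > 0" using n0 assms by (simp add: h_def)
  have close: "dist x y \<le> L * h" if "x \<in> U k" "y \<in> U k" for x y k
  proof -
    have "k < n" using that by (auto simp: U_def split: if_splits)
    then have "x \<in> \<gamma> ` ({real k * h .. real (Suc k) * h} \<inter> {0..T})"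
      "y \<in> \<gamma> ` ({real k * h .. real (Suc k) * h} \<inter> {0..T})"
      using that by (simp_all add: U_def)
    then obtain u v where uv: "x = \<gamma> u" "y = \<gamma> v" "u \<in> {real k * h .. real (Suc k) * h} \<inter> {0..T}"
      "v \<in> {real k * h .. real (Suc k) * h} \<inter> {0..T}"
      by blast
    have "\<bar>u - v\<bar> \<le> h" using uv(3,4) by (auto simp: algebra_simps)
    then have "L * \<bar>u - v\<bar> \<le> L * h" using assms(1) by (rule mult_left_mono)
    then show ?thesis using lip[of u v] uv by simp
  qed
  have bd: "bounded (U k)" for k
    using close by (auto simp: bounded_two_points)
  have diam: "diameter (U k) \<le> L * h" for k
    using close assms(1) h0 by (auto simp: diameter_def intro!: cSUP_least)
  show "hausdorff1_pre \<delta> (\<gamma> ` {0..T}) \<le> ennreal (L * T)"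
  proof -
    have Lh: "L * h \<le> \<delta>" using n n0 \<delta> by (simp add: h_def field_simps)
    have "hausdorff1_pre \<delta> (\<gamma> ` {0..T}) \<le> (\<Sum>k. ennreal (diameter (U k)))"
    proof (rule hausdorff1_pre_bound)
      show "\<gamma> ` {0..T} \<subseteq> (\<Union>k. U k)"
      proof clarify
        fix x assume x: "x \<in> {0..T}"
        show "\<gamma> x \<in> (\<Union>k. U k)"
        \<comment> \<open>At the right endpoint the floor of \<open>x / h\<close> is
          \<open>n\<close>, one past the last piece, so this point is assigned to piece
          \<open>n - 1\<close> by hand.\<close>
        proof (cases "x = T")
          case True
          then obtain m where m: "n = Suc m" using n0 by (cases n) auto
          have "real m * h \<le> T" "T = real (Suc m) * h"
            using m n0 assms(2) by (auto simp: h_def field_simps)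
          then have "\<gamma> x \<in> U m" using x True by (auto simp: U_def m)
          then show ?thesis by blast
        next
          case False
          define k where "k = nat \<lfloor>x / h\<rfloor>"
          have k: "real k \<le> x / h" "x / h < real k + 1"
            using x h0 by (auto simp: k_def)
          then have "real k * h \<le> x" "x \<le> real (Suc k) * h" using h0 by (auto simp: field_simps)
          moreover have "k < n"
          proof -
            have "x / h < n" using x False n0 h0 assms(2) by (simp add: h_def field_simps)
            then show ?thesis using k(1) by linarith
          qed
          ultimately have "\<gamma> x \<in> U k" using x by (auto simp: U_def)
          then show ?thesis by blast
        qed
      qed
    qed (use bd diam Lh in \<open>auto intro: order_trans\<close>)
    also have "\<dots> = (\<Sum>k<n. ennreal (diameter (U k)))"
      by (rule suminf_finite) (auto simp: U_def)
    also have "\<dots> \<le> (\<Sum>k<n. ennreal (L * h))"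
      by (intro sum_mono ennreal_leI diam)
    also have "\<dots> = ennreal (real n * (L * h))"
      using h0 assms(1) by (simp add: ennreal_mult ennreal_of_nat_eq_real_of_nat)
    also have "real n * (L * h) = L * T" using n0 by (simp add: h_def)
    finally show ?thesis .
  qed
qed

text \<open>The slice is a circle of radius \<open>sqrt (1 - t\<^sup>2)\<close>, parametrized by the
  angle in an orthonormal frame \<open>n\<close>, \<open>y\<close>, \<open>x\<close>. Estimating the
  two coordinates separately costs a factor 2 over the true length, which only affects the final
  constant.\<close>

lemma hausdorff1_outer_sphere_slice_le:
  fixes n :: space3
  assumes n: "norm n = 1"
  shows "hausdorff1_outer {\<omega> \<in> sphere 0 1. n \<bullet> \<omega> = t} \<le> ennreal (4 * pi * sqrt (1 - t\<^sup>2))"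
proof -
  have nn: "n \<bullet> n = 1" using n by (simp add: dot_square_norm)
  obtain y where y: "norm y = 1" "n \<bullet> y = 0"
  proof -
    obtain z :: space3 where "z \<noteq> 0" "orthogonal n z"
      using orthogonal_to_vector_exists[of n] by auto
    then show ?thesis by (intro that[of "z /\<^sub>R norm z"]) (auto simp: orthogonal_def)
  qed
  define x where "x = cross3 n y"
  have yy: "y \<bullet> y = 1" using y by (simp add: dot_square_norm)
  have xx: "x \<bullet> x = 1" using nn yy y(2) by (simp add: x_def dot_cross)
  have nx: "n \<bullet> x = 0" and yx: "y \<bullet> x = 0" by (simp_all add: x_def dot_cross_self)
  \<comment> \<open>Instead of a dimension argument, \<open>cross3 x (cross3 w x)\<close> is
    evaluated twice: as \<open>w\<close> without its component along \<open>x\<close>, and, since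
    \<open>cross3 w x\<close> is a multiple of \<open>n\<close>, as a multiple of
    \<open>y\<close>.\<close>
  have dec: "w = (w \<bullet> y) *\<^sub>R y + (w \<bullet> x) *\<^sub>R x" if "n \<bullet> w = 0" for w
  proof -
    have "cross3 w x = (w \<bullet> y) *\<^sub>R n"
      using that unfolding x_def by (simp add: Lagrange inner_commute)
    then have "cross3 x (cross3 w x) = (w \<bullet> y) *\<^sub>R cross3 x n" by (simp add: cross_mult_right)
    moreover have "cross3 x (cross3 w x) = w - (w \<bullet> x) *\<^sub>R x"
      using xx by (simp add: Lagrange inner_commute)
    moreover have "cross3 x n = y"
    proof -
      have "cross3 n x = - y" unfolding x_def using nn y(2) by (simp add: Lagrange)
      then show ?thesis using cross_skew[of x n] by simp
    qed
    ultimately show ?thesis by (simp add: algebra_simps)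
  qed
  show ?thesis
  proof (cases "t\<^sup>2 \<le> 1")
    case False
    have "\<bar>n \<bullet> \<omega>\<bar> \<le> 1" if "norm \<omega> = 1" for \<omega>
      using Cauchy_Schwarz_ineq2[of n \<omega>] n that by simp
    then have "{\<omega> \<in> sphere 0 1. n \<bullet> \<omega> = t} = {}"
      using False by (auto simp: abs_square_le_1)
    then show ?thesis
      using hausdorff1_outer_space by (metis outer_measure_space_def positive_def zero_le)
  next
    case True
    define r where "r = sqrt (1 - t\<^sup>2)"
    have r0: "r \<ge> 0" and r2: "r\<^sup>2 = 1 - t\<^sup>2" using True by (auto simp: r_def)
    define \<gamma> where "\<gamma> \<phi> = t *\<^sub>R n + (r * cos \<phi>) *\<^sub>R y + (r * sin \<phi>) *\<^sub>R x" for \<phi>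
    have lip: "dist (\<gamma> u) (\<gamma> v) \<le> (2 * r) * \<bar>u - v\<bar>" for u v
    proof -
      \<comment> \<open>Sum-to-product formulas: one factor is a sine or cosine bounded by 1, the
        other is the sine of half the difference.\<close>
      have c: "\<bar>cos u - cos v\<bar> \<le> \<bar>u - v\<bar>" and s: "\<bar>sin u - sin v\<bar> \<le> \<bar>u - v\<bar>"
        using mult_mono[OF abs_sin_le_one[of "(u + v) / 2"] abs_sin_x_le_abs_x[of "(v - u) / 2"]]
          mult_mono[OF abs_sin_x_le_abs_x[of "(u - v) / 2"] abs_cos_le_one[of "(u + v) / 2"]]
        by (auto simp: cos_diff_cos sin_diff_sin abs_mult abs_minus_commute)
      have "\<gamma> u - \<gamma> v = (r * (cos u - cos v)) *\<^sub>R y + (r * (sin u - sin v)) *\<^sub>R x"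
        by (simp add: \<gamma>_def algebra_simps)
      then have "dist (\<gamma> u) (\<gamma> v) \<le> norm ((r * (cos u - cos v)) *\<^sub>R y) + norm ((r * (sin u - sin v)) *\<^sub>R x)"
        by (metis dist_norm norm_triangle_ineq)
      also have "\<dots> = r * (\<bar>cos u - cos v\<bar> + \<bar>sin u - sin v\<bar>)"
      proof -
        have "norm x = 1" using xx by (simp add: norm_eq_1)
        then show ?thesis using r0 y(1) by (simp only: norm_scaleR abs_mult) (simp add: distrib_left)
      qed
      also have "\<dots> \<le> r * (\<bar>u - v\<bar> + \<bar>u - v\<bar>)" using c s r0 by (intro mult_left_mono) auto
      finally show ?thesis by simp
    qed
    have sub: "{\<omega> \<in> sphere 0 1. n \<bullet> \<omega> = t} \<subseteq> \<gamma> ` {0..2*pi}"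
    proof safe
      fix \<omega> :: space3 assume \<omega>: "\<omega> \<in> sphere 0 1" and t: "t = n \<bullet> \<omega>"
      define w where "w = \<omega> - t *\<^sub>R n"
      have w0: "n \<bullet> w = 0" using nn t by (simp add: w_def algebra_simps)
      have "w \<bullet> w = (w \<bullet> y)\<^sup>2 + (w \<bullet> x)\<^sup>2"
        by (subst (2) dec[OF w0]) (simp add: inner_right_distrib power2_eq_square)
      moreover have "w \<bullet> w = r\<^sup>2"
      proof -
        have "\<omega> \<bullet> \<omega> = 1" using \<omega> by (simp add: dot_square_norm)
        then show ?thesis unfolding r2 w_def using nn t
          by (simp add: algebra_simps inner_commute power2_eq_square)
      qed
      ultimately have wr: "(w \<bullet> y)\<^sup>2 + (w \<bullet> x)\<^sup>2 = r\<^sup>2" by simp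
      obtain \<phi> where \<phi>: "0 \<le> \<phi>" "\<phi> \<le> 2*pi" "w \<bullet> y = r * cos \<phi>" "w \<bullet> x = r * sin \<phi>"
      \<comment> \<open>In the degenerate circle both coordinates vanish and any angle serves;
        otherwise dividing by \<open>r\<close> gives a point of the unit circle.\<close>
      proof (cases "r = 0")
        case True
        then show ?thesis using wr that[of 0] by (simp add: sum_power2_eq_zero_iff)
      next
        case False
        then have "((w \<bullet> y)/r)\<^sup>2 + ((w \<bullet> x)/r)\<^sup>2 = 1"
          using wr by (simp add: power_divide add_divide_distrib[symmetric])
        from sincos_total_2pi[OF this] obtain \<phi> where "0 \<le> \<phi>" "\<phi> < 2*pi" "(w \<bullet> y)/r = cos \<phi>" "(w \<bullet> x)/r = sin \<phi>"
          by blast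
        then show ?thesis using False by (intro that[of \<phi>]) (auto simp: field_simps)
      qed
      have "\<omega> = \<gamma> \<phi>"
        using dec[OF w0] \<phi>(3,4) unfolding \<gamma>_def w_def by (simp add: algebra_simps)
      then show "\<omega> \<in> \<gamma> ` {0..2*pi}" using \<phi> by auto
    qed
    have "hausdorff1_outer {\<omega> \<in> sphere 0 1. n \<bullet> \<omega> = t} \<le> hausdorff1_outer (\<gamma> ` {0..2*pi})"
      using sub hausdorff1_outer_space by (auto simp: outer_measure_space_def increasing_def)
    also have "\<dots> \<le> ennreal ((2 * r) * (2 * pi))"
      using lip r0 by (intro hausdorff1_outer_lipschitz_image_le) auto
    finally show ?thesis by (simp add: r_def algebra_simps)
  qed
qed

text \<open>The radius of the slice \<open>{H = 0}\<close> cancels against the norm of the tangential gradient of \<open>H\<close>.\<close>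
lemma sphere_delta_affine_le:
  fixes v :: space3
  assumes v: "v \<noteq> 0" and M: "0 \<le> M"
    and F: "\<And>\<omega>. norm \<omega> = 1 \<Longrightarrow> F \<omega> \<le> M"
    and H: "\<And>\<omega>. norm \<omega> = 1 \<Longrightarrow> H \<omega> = \<alpha> + v \<bullet> \<omega>"
    and DH: "\<And>\<omega>. norm \<omega> = 1 \<Longrightarrow> \<exists>k. gderiv H \<omega> (v + k *\<^sub>R \<omega>)"
  shows "sphere_delta F H \<le> ennreal (4 * pi * M / norm v)"
proof -
  define n where "n = v /\<^sub>R norm v"
  define t where "t = - \<alpha> / norm v"
  define r where "r = sqrt (1 - t\<^sup>2)"
  have n1: "norm n = 1" using v by (simp add: n_def)
  have vn: "v = norm v *\<^sub>R n" using v by (simp add: n_def)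
  define S where "S = {\<omega> \<in> sphere 0 1. n \<bullet> \<omega> = t}"
  have SH: "{\<omega> \<in> sphere 0 1. H \<omega> = 0} = S"
  proof -
    have "H \<omega> = 0 \<longleftrightarrow> n \<bullet> \<omega> = t" if "norm \<omega> = 1" for \<omega>
      using H[OF that] v by (simp add: n_def t_def field_simps) linarith
    then show ?thesis by (auto simp: S_def)
  qed
  have Sb: "S \<in> sets borel" unfolding S_def by measurable
  have Sm: "emeasure hausdorff1 S \<le> ennreal (4 * pi * r)"
    using hausdorff1_outer_sphere_slice_le[OF n1, of t] Sb by (simp add: emeasure_hausdorff1 S_def r_def)
  have grad: "norm (sphere_gradient H \<omega>) = norm v * r" if "\<omega> \<in> S" for \<omega>
  proof -
    have \<omega>: "norm \<omega> = 1" "\<omega> \<bullet> \<omega> = 1" "n \<bullet> \<omega> = t" using that by (auto simp: S_def dot_square_norm)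
    obtain k where "gderiv H \<omega> (v + k *\<^sub>R \<omega>)" using DH \<omega>(1) by blast
    \<comment> \<open>The unknown radial term \<open>k *\<^sub>R \<omega>\<close> disappears when
      the component along \<open>\<omega>\<close> is removed.\<close>
    then have "sphere_gradient H \<omega> = v - (v \<bullet> \<omega>) *\<^sub>R \<omega>"
      using \<omega>(2) by (simp add: sphere_gradient_def gradient_eqI algebra_simps)
    also have "\<dots> = norm v *\<^sub>R (n - t *\<^sub>R \<omega>)"
      using \<omega>(3) vn by (metis inner_scaleR_left scaleR_diff_right scaleR_scaleR)
    finally have "norm (sphere_gradient H \<omega>) = norm v * norm (n - t *\<^sub>R \<omega>)" by simp
    moreover have "norm (n - t *\<^sub>R \<omega>) = r"
    proof -
      have "(n - t *\<^sub>R \<omega>) \<bullet> (n - t *\<^sub>R \<omega>) = 1 - t\<^sup>2"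
        using \<omega> n1 by (simp add: algebra_simps inner_commute power2_eq_square norm_eq_1)
      then show ?thesis by (simp add: norm_eq_sqrt_inner r_def)
    qed
    ultimately show ?thesis by simp
  qed
  have "sphere_delta F H \<le> (\<integral>\<^sup>+\<omega>. (ennreal M / ennreal (norm v * r)) * indicator S \<omega> \<partial>hausdorff1)"
    unfolding sphere_delta_def SH
    by (intro nn_integral_mono)
       (auto simp: grad S_def intro!: divide_right_mono_ennreal ennreal_leI F split: split_indicator)
  also have "\<dots> = (ennreal M / ennreal (norm v * r)) * emeasure hausdorff1 S"
    using Sb by (simp add: nn_integral_cmult_indicator)
  also have "\<dots> \<le> (ennreal M / ennreal (norm v * r)) * ennreal (4 * pi * r)"
    by (intro mult_left_mono Sm) auto
  also have "\<dots> \<le> ennreal (4 * pi * M / norm v)"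
  proof (cases "r > 0")
    case True
    then have "(ennreal M / ennreal (norm v * r)) * ennreal (4 * pi * r) = ennreal (M / (norm v * r) * (4 * pi * r))"
      using v M by (subst divide_ennreal) (auto simp: ennreal_mult[symmetric])
    also have "M / (norm v * r) * (4 * pi * r) = 4 * pi * M / norm v" using True v by (simp add: field_simps)
    finally show ?thesis by simp
  next
    \<comment> \<open>Here the plane is tangent to the sphere or misses it (\<open>sqrt\<close> of a
      negative number is negative). The quotient may be infinite, but the slice has length 0 and in
      \<open>ennreal\<close> infinity times 0 is 0.\<close>
    case False
    then have "ennreal (4 * pi * r) = 0" by (simp add: ennreal_eq_0_iff mult_nonneg_nonpos)
    then show ?thesis by simp
  qed
  finally show ?thesis .
qed

section \<open>Energies and the invariants s and g\<close>

lemma en_sq: "(en p)\<^sup>2 = 1 + p \<bullet> p"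
  by (simp add: en_def dot_square_norm)

lemma en_ge_1: "1 \<le> en p"
  by (simp add: en_def)

text \<open>Cauchy-Schwarz for \<open>p\<close> and \<open>q\<close>, then for the pairs
  \<open>(1, norm p)\<close> and \<open>(1, norm q)\<close>. The absolute value serves both signs:
  one gives the lower bound 4 for \<open>s_inv\<close>, the other its upper bound.\<close>

lemma inner_add_1_le_en_mult: "\<bar>p \<bullet> q\<bar> + 1 \<le> en p * en q"
proof -
  have "\<bar>p \<bullet> q\<bar> + 1 \<le> norm p * norm q + 1" using Cauchy_Schwarz_ineq2 by simp
  also have "\<dots> \<le> en p * en q"
    unfolding en_def real_sqrt_mult[symmetric]
  proof (rule real_le_rsqrt)
    show "(norm p * norm q + 1)\<^sup>2 \<le> (1 + (norm p)\<^sup>2) * (1 + (norm q)\<^sup>2)"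
      using sum_squares_bound[of "norm p" "norm q"] by (simp add: power2_eq_square algebra_simps)
  qed
  finally show ?thesis .
qed

lemma s_inv_eq: "s_inv p q = 2 * (en p * en q - p \<bullet> q + 1)"
  by (simp add: s_inv_def lorentz_def mom_def)

lemma s_inv_eq_total: "s_inv p q = (en p + en q)\<^sup>2 - (p + q) \<bullet> (p + q)"
  using en_sq[of p] en_sq[of q] by (simp add: s_inv_eq power2_eq_square algebra_simps inner_commute)

lemma s_inv_ge_4: "4 \<le> s_inv p q"
  using inner_add_1_le_en_mult[of p q] by (simp add: s_inv_eq)

lemma s_inv_le: "s_inv p q \<le> 4 * (en p * en q)"
  using inner_add_1_le_en_mult[of p q] by (simp add: s_inv_eq)

text \<open>The total momentum is time-like, because the difference of the two squares is
  \<open>s_inv p q\<close>.\<close>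

lemma norm_add_less_en_add: "norm (p + q) < en p + en q"
proof (rule power2_less_imp_less)
  show "(norm (p + q))\<^sup>2 < (en p + en q)\<^sup>2"
    using s_inv_eq_total[of p q] s_inv_ge_4[of p q] by (simp add: dot_square_norm)
  show "0 \<le> en p + en q" using en_ge_1[of p] en_ge_1[of q] by linarith
qed

lemma lorentz_mom_diff: "lorentz (mom p - mom q) (mom p - mom q) = s_inv p q - 4"
  using en_sq[of p] en_sq[of q]
  by (simp add: lorentz_def mom_def s_inv_eq power2_eq_square algebra_simps inner_commute)

lemma g_rel_sq: "(g_rel p q)\<^sup>2 = s_inv p q - 4"
  using s_inv_ge_4[of p q] by (simp add: g_rel_def lorentz_mom_diff)

lemma g_rel_nonneg: "0 \<le> g_rel p q"
  using s_inv_ge_4[of p q] by (simp add: g_rel_def lorentz_mom_diff)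

lemma gamma_cm_sq: "(gamma_cm p q)\<^sup>2 - 1 = (p + q) \<bullet> (p + q) / s_inv p q"
  using s_inv_eq_total[of p q] s_inv_ge_4[of p q]
  by (simp add: gamma_cm_def power_divide field_simps)

section \<open>The boost out of the center-of-mass frame and the post-collisional energies\<close>

text \<open>The correction term in \<open>scatter_dir\<close> stretches the component of
  \<open>x\<close> along \<open>p + q\<close> by \<open>gamma_cm p q\<close> and leaves the
  orthogonal part alone.\<close>

lemma inner_total_scatter_dir:
  "(p + q) \<bullet> scatter_dir p q x = gamma_cm p q * ((p + q) \<bullet> x)"
proof (cases "p + q = 0")
  case False
  define P where "P = p + q"
  have "P \<bullet> P \<noteq> 0" using False by (simp add: P_def)
  then show ?thesis
    unfolding scatter_dir_def P_def[symmetric] dot_square_norm[symmetric]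
    by (simp add: inner_right_distrib field_simps)
qed simp

text \<open>\<open>scatter_dir p q\<close> is the identity plus a multiple of the projection onto
  \<open>p + q\<close>, hence symmetric. This moves it from the scattering direction onto the
  spatial part of the fixed vector.\<close>

lemma inner_scatter_dir_commute: "a \<bullet> scatter_dir p q x = scatter_dir p q a \<bullet> x"
  by (simp add: scatter_dir_def inner_right_distrib inner_left_distrib inner_commute)

lemma scatter_dir_minus: "scatter_dir p q (- x) = - scatter_dir p q x"
  by (simp add: scatter_dir_def)

text \<open>The boost sends \<open>(0, x)\<close> to the 4-vector with time component
  \<open>(p + q) \<bullet> x / sqrt (s_inv p q)\<close> and spatial part
  \<open>scatter_dir p q x\<close>, and it preserves the Lorentz square.\<close>

lemma scatter_dir_inner_self:
  "scatter_dir p q x \<bullet> scatter_dir p q x = x \<bullet> x + ((p + q) \<bullet> x)\<^sup>2 / s_inv p q"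
proof (cases "p + q = 0")
  case True
  then show ?thesis by (simp add: scatter_dir_def)
next
  case False
  define P where "P = p + q"
  define N where "N = P \<bullet> P"
  define \<gamma> where "\<gamma> = gamma_cm p q"
  define u where "u = P \<bullet> x"
  have N: "N > 0" using False by (simp add: N_def P_def)
  have L: "scatter_dir p q x = x + ((\<gamma> - 1) * u / N) *\<^sub>R P"
    by (simp add: scatter_dir_def P_def N_def u_def \<gamma>_def dot_square_norm power_divide)
  have "scatter_dir p q x \<bullet> scatter_dir p q x
      = x \<bullet> x + 2 * ((\<gamma> - 1) * u / N) * u + ((\<gamma> - 1) * u / N)\<^sup>2 * N"
    unfolding L by (simp add: N_def u_def inner_left_distrib inner_right_distrib inner_commute power2_eq_square)
  \<comment> \<open>The linear and quadratic terms combine through 2(\<gamma> - 1) + (\<gamma> -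
    1)^2 = \<gamma>^2 - 1.\<close>
  also have "\<dots> = x \<bullet> x + (\<gamma>\<^sup>2 - 1) * (u\<^sup>2 / N)"
    using N by (simp add: field_simps power2_eq_square)
  also have "(\<gamma>\<^sup>2 - 1) * (u\<^sup>2 / N) = u\<^sup>2 / s_inv p q"
    using N unfolding \<gamma>_def gamma_cm_sq by (simp add: N_def P_def)
  finally show ?thesis by (simp add: u_def P_def)
qed

text \<open>Half the total energy plus \<open>g/2\<close> times the time component of the boosted
  \<open>(0, x)\<close>. It is affine in \<open>x\<close> and agrees with the energy of
  \<open>p_post\<close> on the unit sphere.\<close>

definition post_energy :: "space3 \<Rightarrow> space3 \<Rightarrow> space3 \<Rightarrow> real" where
  "post_energy p q x = (en p + en q) / 2 + (g_rel p q / (2 * sqrt (s_inv p q))) *\<^sub>R (p + q) \<bullet> x"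

text \<open>
  Holding also off the unit sphere, this gives the value of the energy of \<open>p'\<close> on the sphere as well
  as its gradient there.
\<close>
lemma en_p_post:
  "en (p_post p q x) = sqrt ((post_energy p q x)\<^sup>2 + (g_rel p q)\<^sup>2 / 4 * (x \<bullet> x - 1))"
proof -
  define P where "P = p + q"
  define E where "E = en p + en q"
  define g where "g = g_rel p q"
  define S where "S = sqrt (s_inv p q)"
  define u where "u = P \<bullet> x"
  have S0: "S > 0" and S2: "s_inv p q = S\<^sup>2" using s_inv_ge_4[of p q] by (simp_all add: S_def)
  have g2: "g\<^sup>2 = S\<^sup>2 - 4" and P2: "P \<bullet> P = E\<^sup>2 - S\<^sup>2"
    using s_inv_eq_total[of p q] by (simp_all add: g_def g_rel_sq S2 P_def E_def)
  have PL: "P \<bullet> scatter_dir p q x = E * u / S"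
    using inner_total_scatter_dir[of p q x] by (simp add: P_def E_def u_def S_def gamma_cm_def)
  have LL: "scatter_dir p q x \<bullet> scatter_dir p q x = x \<bullet> x + u\<^sup>2 / S\<^sup>2"
    using scatter_dir_inner_self[of p q x] by (simp add: P_def u_def S2)
  have "p_post p q x \<bullet> p_post p q x
      = (P \<bullet> P) / 4 + g / 2 * (P \<bullet> scatter_dir p q x) + g\<^sup>2 / 4 * (scatter_dir p q x \<bullet> scatter_dir p q x)"
    by (simp add: p_post_def P_def[symmetric] g_def[symmetric] inner_left_distrib inner_right_distrib
        inner_commute power2_eq_square)
  also have "\<dots> + 1 = (E / 2 + g / (2 * S) * u)\<^sup>2 + g\<^sup>2 / 4 * (x \<bullet> x - 1)"
  proof -
    have "(E / 2 + g / (2 * S) * u)\<^sup>2 = E\<^sup>2 / 4 + g / 2 * (E * u / S) + g\<^sup>2 / 4 * (u\<^sup>2 / S\<^sup>2)"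
      using S0 by (simp add: power2_eq_square field_simps)
    \<comment> \<open>The rest mass is absorbed by g^2 = s - 4; the remaining -g^2/4 turns
      \<open>x \<bullet> x\<close> into \<open>x \<bullet> x - 1\<close>.\<close>
    moreover have "E\<^sup>2 / 4 - S\<^sup>2 / 4 + 1 = E\<^sup>2 / 4 - g\<^sup>2 / 4" unfolding g2 by (simp add: field_simps)
    ultimately show ?thesis unfolding PL LL P2 by (simp add: ring_distribs diff_divide_distrib)
  qed
  finally show ?thesis
    by (simp add: en_def post_energy_def dot_square_norm P_def E_def g_def S_def u_def add.commute)
qed

text \<open>Follows from g <= sqrt s and the time-like total momentum. The strictness makes
  \<open>post_energy\<close> positive, so the square root in \<open>en_p_post\<close> can be
  resolved and differentiated.\<close>

lemma abs_post_energy_diff_less: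
  assumes "norm \<omega> = 1"
  shows "\<bar>post_energy p q \<omega> - (en p + en q) / 2\<bar> < (en p + en q) / 2"
proof -
  define S where "S = sqrt (s_inv p q)"
  have S0: "S > 0" using s_inv_ge_4[of p q] by (simp add: S_def)
  have gS: "g_rel p q \<le> S"
    unfolding S_def using g_rel_sq[of p q] by (intro real_le_rsqrt) simp
  have PE: "norm (p + q) < en p + en q" by (rule norm_add_less_en_add)
  have "\<bar>post_energy p q \<omega> - (en p + en q) / 2\<bar> = g_rel p q / S * \<bar>(p + q) \<bullet> \<omega>\<bar> / 2"
    using S0 g_rel_nonneg[of p q] by (simp add: post_energy_def S_def[symmetric] abs_mult)
  also have "\<dots> \<le> 1 * norm (p + q) / 2"
    using Cauchy_Schwarz_ineq2[of "p + q" \<omega>] assms gS S0 g_rel_nonneg[of p q]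
    by (intro divide_right_mono mult_mono) auto
  finally show ?thesis using PE by simp
qed

lemma post_energy_pos: "norm \<omega> = 1 \<Longrightarrow> 0 < post_energy p q \<omega>"
  by (drule abs_post_energy_diff_less[of \<omega> p q]) linarith

lemma post_energy_le: "norm \<omega> = 1 \<Longrightarrow> post_energy p q \<omega> \<le> en p + en q"
  by (drule abs_post_energy_diff_less[of \<omega> p q]) (simp add: abs_less_iff field_simps)

lemma en_p_post_sphere: "norm \<omega> = 1 \<Longrightarrow> en (p_post p q \<omega>) = post_energy p q \<omega>"
  using post_energy_pos[of \<omega> p q] by (simp add: en_p_post dot_square_norm)

lemma q_post_eq: "q_post p q \<omega> = p_post p q (- \<omega>)"
  by (simp add: p_post_def q_post_def scatter_dir_minus)

lemma mom_post_add:
  assumes "norm \<omega> = 1"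
  shows "mom (p_post p q \<omega>) + mom (q_post p q \<omega>) = mom p + mom q"
proof -
  have "en (p_post p q \<omega>) + en (q_post p q \<omega>) = en p + en q"
    using assms by (simp add: q_post_eq en_p_post_sphere post_energy_def)
  moreover have "p_post p q \<omega> + q_post p q \<omega> = p + q"
    by (simp add: p_post_def q_post_def vec_eq_iff)
  ultimately show ?thesis by (simp add: mom_def)
qed

section \<open>Range of the scattering angle\<close>

text \<open>Orthogonality and Cauchy-Schwarz bound the time component of \<open>u\<close> by the
  norm of its spatial part.\<close>

lemma lorentz_self_nonneg_if_orthogonal_timelike:
  assumes E: "norm P < E" and u: "lorentz u (E, P) = 0"
  shows "0 \<le> lorentz u u"
proof -
  have E0: "E > 0" using E norm_ge_zero le_less_trans by blast
  have "\<bar>fst u\<bar> * E = \<bar>snd u \<bullet> P\<bar>" using u E0 by (simp add: lorentz_def abs_mult)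
  also have "\<dots> \<le> norm (snd u) * norm P" by (rule Cauchy_Schwarz_ineq2)
  also have "\<dots> \<le> norm (snd u) * E" using E by (intro mult_left_mono) auto
  finally have "\<bar>fst u\<bar> \<le> norm (snd u)" using E0 by simp
  then have "\<bar>fst u\<bar>\<^sup>2 \<le> (norm (snd u))\<^sup>2" by (intro power_mono) auto
  then show ?thesis by (simp add: lorentz_def dot_square_norm power2_eq_square)
qed

lemma lorentz_mom_self: "lorentz (mom p) (mom p) = -1"
  using en_sq[of p] by (simp add: lorentz_def mom_def power2_eq_square)

lemma lorentz_simps:
  "lorentz (u + v) w = lorentz u w + lorentz v w" "lorentz (u - v) w = lorentz u w - lorentz v w"
  "lorentz u (v + w) = lorentz u v + lorentz u w" "lorentz u (v - w) = lorentz u v - lorentz u w"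
  by (simp_all add: lorentz_def algebra_simps)

lemma lorentz_commute: "lorentz u v = lorentz v u"
  by (simp add: lorentz_def inner_commute mult.commute)

lemma lorentz_mom_diff_total: "lorentz (mom p - mom q) (mom p + mom q) = 0"
  by (simp add: lorentz_simps lorentz_mom_self lorentz_commute[of "mom q" "mom p"])

lemma lorentz_mom_diff_self_total:
  "lorentz (mom p - mom q) (mom p - mom q) = - 4 - lorentz (mom p + mom q) (mom p + mom q)"
  by (simp add: lorentz_simps lorentz_mom_self)

text \<open>A Cauchy-Schwarz inequality for an indefinite form: both relative momenta are orthogonal
  to the same time-like total and have Lorentz square g^2, so the squares of their sum and
  difference are nonnegative.\<close>

lemma abs_lorentz_mom_diff_le:
  assumes tot: "mom p' + mom q' = mom p + mom q"
  shows "\<bar>lorentz (mom p - mom q) (mom p' - mom q')\<bar> \<le> (g_rel p q)\<^sup>2"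
proof -
  define u where "u = mom p - mom q"
  define v where "v = mom p' - mom q'"
  have uu: "lorentz u u = (g_rel p q)\<^sup>2" by (simp add: u_def lorentz_mom_diff g_rel_sq)
  have vv: "lorentz v v = (g_rel p q)\<^sup>2"
    using uu unfolding u_def v_def lorentz_mom_diff_self_total tot .
  have T: "mom p + mom q = (en p + en q, p + q)" by (simp add: mom_def)
  have "lorentz u (en p + en q, p + q) = 0" "lorentz v (en p + en q, p + q) = 0"
    using lorentz_mom_diff_total[of p q] lorentz_mom_diff_total[of p' q'] by (simp_all add: u_def v_def T tot)
  then have "0 \<le> lorentz (u + v) (u + v)" "0 \<le> lorentz (u - v) (u - v)"
    by (auto intro!: lorentz_self_nonneg_if_orthogonal_timelike[OF norm_add_less_en_add[of p q]]
        simp: lorentz_simps(1,2)[of _ _ "(en p + en q, p + q)"])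
  then have "\<bar>lorentz u v\<bar> \<le> (g_rel p q)\<^sup>2"
    using uu vv by (simp add: lorentz_simps lorentz_commute[of v u])
  then show ?thesis by (simp add: u_def v_def)
qed

text \<open>Needed because the kernel bound is assumed only for angles in \<open>{0..pi}\<close>.
  For g = 0 the quotient is 0 by division by zero, still a legitimate argument of
  \<open>arccos\<close>.\<close>

lemma scatter_angle_mem:
  assumes "norm \<omega> = 1"
  shows "scatter_angle p q \<omega> \<in> {0..pi}"
proof -
  define c where "c = lorentz (mom p - mom q) (mom (p_post p q \<omega>) - mom (q_post p q \<omega>)) / (g_rel p q)\<^sup>2"
  have "\<bar>c\<bar> \<le> 1"
    using abs_lorentz_mom_diff_le[OF mom_post_add[OF assms, of p q]]
    by (simp add: c_def divide_le_eq_1)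
  then show ?thesis
    unfolding scatter_angle_def c_def[symmetric] by (auto intro: arccos_lbound arccos_ubound)
qed

section \<open>The argument of the delta as an affine function on the sphere, and its
  gradient\<close>

definition cm_covector :: "fourvec \<Rightarrow> space3 \<Rightarrow> space3 \<Rightarrow> space3" where
  "cm_covector a p q = scatter_dir p q (snd a) - (fst a / sqrt (s_inv p q)) *\<^sub>R (p + q)"

text \<open>
  The covector is the spatial part of \<open>a\<close> in the center-of-mass frame, where the Lorentz square of
  \<open>a\<close> falls short of its square length by the square of the time component of \<open>a\<close>.
\<close>
lemma lorentz_le_cm_covector: "lorentz a a \<le> (norm (cm_covector a p q))\<^sup>2"
proof -
  define P where "P = p + q"
  define E where "E = en p + en q"
  define S where "S = sqrt (s_inv p q)"
  define u where "u = P \<bullet> snd a"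
  have S0: "S > 0" and S2: "s_inv p q = S\<^sup>2" using s_inv_ge_4[of p q] by (simp_all add: S_def)
  have P2: "P \<bullet> P = E\<^sup>2 - S\<^sup>2"
    using s_inv_eq_total[of p q] by (simp add: S2 P_def E_def)
  have PL: "P \<bullet> scatter_dir p q (snd a) = E * u / S"
    using inner_total_scatter_dir[of p q "snd a"] by (simp add: P_def E_def u_def S_def gamma_cm_def)
  have LL: "scatter_dir p q (snd a) \<bullet> scatter_dir p q (snd a) = snd a \<bullet> snd a + u\<^sup>2 / S\<^sup>2"
    using scatter_dir_inner_self[of p q "snd a"] by (simp add: P_def u_def S2)
  have "(norm (cm_covector a p q))\<^sup>2 = scatter_dir p q (snd a) \<bullet> scatter_dir p q (snd a)
      - 2 * (fst a / S) * (P \<bullet> scatter_dir p q (snd a)) + (fst a / S)\<^sup>2 * (P \<bullet> P)"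
    unfolding cm_covector_def S_def[symmetric] P_def[symmetric] power2_norm_eq_inner
    by (simp add: inner_diff_left inner_diff_right inner_commute power2_eq_square)
  also have "\<dots> = lorentz a a + ((u - fst a * E) / S)\<^sup>2"
    unfolding PL LL P2 using S0 by (simp add: lorentz_def power2_eq_square field_simps)
  finally show ?thesis by simp
qed

text \<open>Stated for all \<open>x\<close>, with the energy left unresolved, so that it can be
  differentiated in the ambient space.\<close>

lemma lorentz_p_post:
  "lorentz a (mom (p_post p q x) - b) =
     - fst a * en (p_post p q x) + ((g_rel p q / 2) *\<^sub>R scatter_dir p q (snd a)) \<bullet> x
     + (fst a * fst b + snd a \<bullet> ((1/2) *\<^sub>R (p + q) - snd b))"
  by (simp add: lorentz_def mom_def p_post_def inner_scatter_dir_commute algebra_simps)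

lemma lorentz_p_post_sphere:
  assumes "norm \<omega> = 1"
  shows "lorentz a (mom (p_post p q \<omega>) - b) =
     (fst a * fst b + snd a \<bullet> ((1/2) *\<^sub>R (p + q) - snd b) - fst a * (en p + en q) / 2)
     + ((g_rel p q / 2) *\<^sub>R cm_covector a p q) \<bullet> \<omega>"
  unfolding lorentz_p_post en_p_post_sphere[OF assms] post_energy_def cm_covector_def
  by (simp add: algebra_simps add_divide_distrib)

text \<open>At a unit vector the root equals \<open>e + w \<bullet> \<omega>\<close>, and the term
  vanishing on the sphere contributes only in the radial direction.\<close>

lemma gderiv_sqrt_quadratic:
  fixes w \<omega> :: "'a::real_inner"
  assumes "norm \<omega> = 1" and pos: "0 < e + w \<bullet> \<omega>"
  shows "gderiv (\<lambda>x. sqrt ((e + w \<bullet> x)\<^sup>2 + c * (x \<bullet> x - 1))) \<omega> (w + (c / (e + w \<bullet> \<omega>)) *\<^sub>R \<omega>)"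
proof -
  have 1: "\<omega> \<bullet> \<omega> = 1" using assms(1) by (simp add: dot_square_norm)
  show ?thesis
    unfolding gderiv_def
  proof (rule has_derivative_eq_rhs[OF has_derivative_real_sqrt])
    show "((\<lambda>x. (e + w \<bullet> x)\<^sup>2 + c * (x \<bullet> x - 1)) has_derivative
        (\<lambda>h. 2 * (e + w \<bullet> \<omega>) * (w \<bullet> h) + 2 * c * (\<omega> \<bullet> h))) (at \<omega>)"
      by (auto intro!: derivative_eq_intros simp: inner_commute)
  next
    show "(\<lambda>h. (2 * (e + w \<bullet> \<omega>) * (w \<bullet> h) + 2 * c * (\<omega> \<bullet> h)) *
        (inverse (sqrt ((e + w \<bullet> \<omega>)\<^sup>2 + c * (\<omega> \<bullet> \<omega> - 1))) / 2))
      = (\<lambda>h. h \<bullet> (w + (c / (e + w \<bullet> \<omega>)) *\<^sub>R \<omega>))"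
    proof
      fix h
      show "(2 * (e + w \<bullet> \<omega>) * (w \<bullet> h) + 2 * c * (\<omega> \<bullet> h)) *
          (inverse (sqrt ((e + w \<bullet> \<omega>)\<^sup>2 + c * (\<omega> \<bullet> \<omega> - 1))) / 2)
        = h \<bullet> (w + (c / (e + w \<bullet> \<omega>)) *\<^sub>R \<omega>)"
        using pos 1 by (simp add: inner_right_distrib inner_commute[of h] field_simps)
    qed
  qed (use pos 1 in simp)
qed

lemma gderiv_lorentz_p_post:
  assumes "norm \<omega> = 1"
  shows "\<exists>k. gderiv (\<lambda>x. lorentz a (mom (p_post p q x) - b)) \<omega>
    ((g_rel p q / 2) *\<^sub>R cm_covector a p q + k *\<^sub>R \<omega>)"
proof -
  let ?w = "(g_rel p q / (2 * sqrt (s_inv p q))) *\<^sub>R (p + q)"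
  let ?v = "(g_rel p q / 2) *\<^sub>R scatter_dir p q (snd a)"
  define k where "k = (g_rel p q)\<^sup>2 / 4 / post_energy p q \<omega>"
  have "gderiv (\<lambda>x. en (p_post p q x)) \<omega> (?w + k *\<^sub>R \<omega>)"
    using gderiv_sqrt_quadratic[of \<omega> "(en p + en q) / 2" ?w "(g_rel p q)\<^sup>2 / 4"] assms
      post_energy_pos[OF assms, of p q]
    by (simp add: en_p_post post_energy_def k_def)
  then have "((\<lambda>x. - fst a * en (p_post p q x) + ?v \<bullet> x
      + (fst a * fst b + snd a \<bullet> ((1/2) *\<^sub>R (p + q) - snd b))) has_derivative
      (\<lambda>h. - fst a * (h \<bullet> (?w + k *\<^sub>R \<omega>)) + ?v \<bullet> h)) (at \<omega>)"
    unfolding gderiv_def by (auto intro!: derivative_eq_intros)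
  moreover have "(\<lambda>h. - fst a * (h \<bullet> (?w + k *\<^sub>R \<omega>)) + ?v \<bullet> h)
      = (\<lambda>h. h \<bullet> ((g_rel p q / 2) *\<^sub>R cm_covector a p q + (- fst a * k) *\<^sub>R \<omega>))"
    by (rule ext) (simp add: cm_covector_def algebra_simps inner_commute)
  ultimately show ?thesis
    unfolding gderiv_def lorentz_p_post by (intro exI[of _ "- fst a * k"]) simp
qed

section \<open>The pointwise bound and its integration\<close>

lemma v_moller_le: "v_moller p q \<le> 4"
proof -
  have "g_rel p q \<le> sqrt (s_inv p q)"
    using g_rel_sq[of p q] by (intro real_le_rsqrt) simp
  then have "g_rel p q * sqrt (s_inv p q) \<le> sqrt (s_inv p q) * sqrt (s_inv p q)"
    using s_inv_ge_4[of p q] by (intro mult_right_mono) auto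
  also have "\<dots> \<le> 4 * (en p * en q)" using s_inv_le[of p q] s_inv_ge_4[of p q] by simp
  finally show ?thesis
    using en_ge_1[of p] en_ge_1[of q] by (simp add: v_moller_def divide_le_eq)
qed

lemma v_moller_nonneg: "0 \<le> v_moller p q"
  using g_rel_nonneg[of p q] s_inv_ge_4[of p q] en_ge_1[of p] en_ge_1[of q] by (simp add: v_moller_def)

lemma en_p_post_powr_le:
  assumes "norm \<omega> = 1"
  shows "en (p_post p q \<omega>) powr (1/2) \<le> 2 * (en p powr (1/2) * en q powr (1/2))"
proof -
  have e: "1 \<le> en p" "1 \<le> en q" by (rule en_ge_1)+
  have "en (p_post p q \<omega>) \<le> en p + en q" using assms by (simp add: en_p_post_sphere post_energy_le)
  \<comment> \<open>A factor 2 would do; 4 is taken for its rational square root.\<close>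
  also have "\<dots> \<le> 4 * (en p * en q)"
    using e mult_mono[of 1 "en p" 1 "en q"] mult_left_mono[of 1 "en q" "en p"] mult_right_mono[of 1 "en p" "en q"]
    by linarith
  finally have "sqrt (en (p_post p q \<omega>)) \<le> sqrt (4 * (en p * en q))" by simp
  then show ?thesis
    using e en_ge_1[of "p_post p q \<omega>"] by (simp add: powr_half_sqrt real_sqrt_mult)
qed

lemma sphere_delta_gain_le:
  assumes c: "0 < c"
    and \<sigma>: "\<And>g \<theta>. 0 \<le> g \<Longrightarrow> \<theta> \<in> {0..pi} \<Longrightarrow> \<sigma> g \<theta> \<le> c * g"
    and a: "space_like a" and f: "\<And>p. 0 \<le> f p"
  shows "sphere_delta
      (\<lambda>\<omega>. v_moller p q * \<sigma> (g_rel p q) (scatter_angle p q \<omega>) * f p * f q * en (p_post p q \<omega>) powr (1/2))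
      (\<lambda>\<omega>. lorentz a (mom (p_post p q \<omega>) - b))
    \<le> ennreal (64 * pi * c / sqrt (lorentz a a) * (en p powr (1/2) * \<bar>f p\<bar>) * (en q powr (1/2) * \<bar>f q\<bar>))"
    (is "sphere_delta ?F ?H \<le> ennreal ?B")
proof (cases "g_rel p q = 0")
  \<comment> \<open>The weight vanishes with \<open>v_moller\<close>. The gradient may vanish too,
    but 0 / 0 is 0 in \<open>ennreal\<close>.\<close>
  case True
  then show ?thesis by (simp add: sphere_delta_def v_moller_def)
next
  case False
  define g where "g = g_rel p q"
  define d where "d = cm_covector a p q"
  define W where "W = (en p powr (1/2) * f p) * (en q powr (1/2) * f q)"
  have g0: "g > 0" using False g_rel_nonneg[of p q] by (simp add: g_def)
  have aa: "0 < lorentz a a" using a by (simp add: space_like_def)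
  \<comment> \<open>Source of the factor \<open>1 / sqrt (lorentz a a)\<close>; it also shows that
    the affine function is not constant.\<close>
  have da: "sqrt (lorentz a a) \<le> norm d"
    using lorentz_le_cm_covector[of a p q] by (simp add: d_def real_le_lsqrt)
  then have d0: "norm d > 0" using aa by (smt (verit) real_sqrt_gt_zero)
  have W0: "W \<ge> 0" using f by (simp add: W_def)
  \<comment> \<open>The 8 is the 4 of \<open>v_moller_le\<close> times the 2 of
    \<open>en_p_post_powr_le\<close>.\<close>
  have F: "?F \<omega> \<le> 8 * c * g * W" if \<omega>: "norm \<omega> = 1" for \<omega>
  proof -
    have "\<sigma> g (scatter_angle p q \<omega>) \<le> c * g" using \<sigma> scatter_angle_mem[OF \<omega>] g0 by simp
    then have "v_moller p q * \<sigma> g (scatter_angle p q \<omega>) \<le> v_moller p q * (c * g)"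
      using v_moller_nonneg by (rule mult_left_mono)
    also have "\<dots> \<le> 4 * (c * g)" using v_moller_le c g0 by (intro mult_right_mono) auto
    finally have "v_moller p q * \<sigma> g (scatter_angle p q \<omega>) * (f p * f q * en (p_post p q \<omega>) powr (1/2))
      \<le> 4 * (c * g) * (f p * f q * en (p_post p q \<omega>) powr (1/2))"
      using f by (intro mult_right_mono) auto
    also have "\<dots> \<le> 4 * (c * g) * (f p * f q * (2 * (en p powr (1/2) * en q powr (1/2))))"
      using f c g0 by (intro mult_left_mono en_p_post_powr_le \<omega>) auto
    finally show ?thesis by (simp add: W_def g_def mult_ac)
  qed
  have "sphere_delta ?F ?H \<le> ennreal (4 * pi * (8 * c * g * W) / norm ((g / 2) *\<^sub>R d))"
  proof (rule sphere_delta_affine_le)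
    show "(g / 2) *\<^sub>R d \<noteq> 0" using g0 d0 by auto
    show "0 \<le> 8 * c * g * W" using c g0 W0 by simp
  qed (use F lorentz_p_post_sphere gderiv_lorentz_p_post in \<open>auto simp: g_def d_def\<close>)
  also have "4 * pi * (8 * c * g * W) / norm ((g / 2) *\<^sub>R d) = 64 * pi * c * W / norm d"
    using g0 by (simp add: field_simps)
  also have "ennreal \<dots> \<le> ennreal (64 * pi * c * W / sqrt (lorentz a a))"
    using da aa c W0 d0 by (intro ennreal_leI divide_left_mono mult_pos_pos) auto
  also have "64 * pi * c * W / sqrt (lorentz a a) = ?B"
    using f by (simp add: W_def)
  finally show ?thesis .
qed

lemma continuous_on_en: "continuous_on S en"
  unfolding en_def by (intro continuous_intros)

lemma integrable_weight_mono:
  assumes "in_L1 l f" "k \<le> l"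
  shows "integrable lebesgue (\<lambda>p. en p powr k * \<bar>f p\<bar>)"
proof (rule Bochner_Integration.integrable_bound)
  show "integrable lebesgue (\<lambda>p. en p powr l * \<bar>f p\<bar>)" using assms(1) by (simp add: in_L1_def)
  have [measurable]: "f \<in> borel_measurable lebesgue" using assms(1) by (simp add: in_L1_def)
  have [measurable]: "en \<in> borel_measurable lebesgue"
    using continuous_on_en by (intro measurable_completion) (simp add: borel_measurable_continuous_onI)
  show "(\<lambda>p. en p powr k * \<bar>f p\<bar>) \<in> borel_measurable lebesgue" by measurable
  show "AE p in lebesgue. norm (en p powr k * \<bar>f p\<bar>) \<le> norm (en p powr l * \<bar>f p\<bar>)"
    using assms(2) en_ge_1 by (auto simp: abs_mult intro!: mult_right_mono powr_mono)
qed

theorem proposition3p3: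
  fixes \<sigma> :: "real \<Rightarrow> real \<Rightarrow> real"
  assumes "collision_kernel \<sigma>" and "kernel_approx_g \<sigma>"
  shows "\<exists>C>0. \<forall>(a :: fourvec) (b :: fourvec) (f :: space3 \<Rightarrow> real).
    space_like a \<longrightarrow> energy_momentum b \<longrightarrow> (\<forall>p. 0 \<le> f p) \<longrightarrow> in_L1 1 f \<longrightarrow>
    gain_tested \<sigma> f f (\<lambda>p. en p powr (1/2)) (\<lambda>p. lorentz a (mom p - b))
      \<le> ennreal (C / sqrt (lorentz a a) * (L1_norm (1/2) f)\<^sup>2)"
proof -
  obtain c where c: "0 < c" and \<sigma>: "\<And>g \<theta>. 0 \<le> g \<Longrightarrow> \<theta> \<in> {0..pi} \<Longrightarrow> \<sigma> g \<theta> \<le> c * g"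
    using assms(2) unfolding kernel_approx_g_def by blast
  show ?thesis
  proof (intro exI[of _ "64 * pi * c"] conjI allI impI)
    show "0 < 64 * pi * c" using c by simp
    fix a b :: fourvec and f :: "space3 \<Rightarrow> real"
    assume a: "space_like a" and f: "\<forall>p. 0 \<le> f p" and L: "in_L1 1 f"
    define h where "h p = en p powr (1/2) * \<bar>f p\<bar>" for p
    define K where "K = 64 * pi * c / sqrt (lorentz a a)"
    have K0: "K \<ge> 0" using a c by (simp add: K_def space_like_def)
    have h0: "h p \<ge> 0" for p by (simp add: h_def)
    \<comment> \<open>Integrability, inherited from the stronger weight since energies are at least
      1, is essential: otherwise \<open>L1_norm (1/2) f\<close> would be the default value 0 of the
      integral.\<close>
    have hi: "integrable lebesgue h" unfolding h_def using L by (rule integrable_weight_mono) simp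
    then have hm: "h \<in> borel_measurable lebesgue" by simp
    have I: "(\<integral>\<^sup>+p. ennreal (h p) \<partial>lebesgue) = ennreal (L1_norm (1/2) f)"
      using hi h0 by (subst nn_integral_eq_integral) (auto simp: L1_norm_def h_def[abs_def])
    have N0: "L1_norm (1/2) f \<ge> 0" unfolding L1_norm_def by (rule Bochner_Integration.integral_nonneg) simp
    have "gain_tested \<sigma> f f (\<lambda>p. en p powr (1/2)) (\<lambda>p. lorentz a (mom p - b))
        \<le> (\<integral>\<^sup>+p. \<integral>\<^sup>+q. ennreal (K * h p * h q) \<partial>lebesgue \<partial>lebesgue)"
      unfolding gain_tested_def K_def h_def
      using f by (intro nn_integral_mono sphere_delta_gain_le c \<sigma> a) auto
    also have "\<dots> = (\<integral>\<^sup>+p. ennreal (K * L1_norm (1/2) f) * ennreal (h p) \<partial>lebesgue)"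
    proof (rule nn_integral_cong)
      fix p
      have "(\<integral>\<^sup>+q. ennreal (K * h p * h q) \<partial>lebesgue) = (\<integral>\<^sup>+q. ennreal (K * h p) * ennreal (h q) \<partial>lebesgue)"
        using K0 h0 by (simp add: ennreal_mult)
      also have "\<dots> = ennreal (K * h p) * ennreal (L1_norm (1/2) f)"
        using hm by (subst nn_integral_cmult) (auto simp: I)
      finally show "(\<integral>\<^sup>+q. ennreal (K * h p * h q) \<partial>lebesgue) = ennreal (K * L1_norm (1/2) f) * ennreal (h p)"
        using K0 h0 N0 by (simp add: ennreal_mult mult_ac)
    qed
    also have "\<dots> = ennreal (K * L1_norm (1/2) f) * ennreal (L1_norm (1/2) f)"
      using hm by (subst nn_integral_cmult) (auto simp: I)
    also have "\<dots> = ennreal (K * (L1_norm (1/2) f)\<^sup>2)"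
      using K0 N0 by (simp add: ennreal_mult[symmetric] power2_eq_square mult_ac)
    finally show "gain_tested \<sigma> f f (\<lambda>p. en p powr (1/2)) (\<lambda>p. lorentz a (mom p - b))
        \<le> ennreal (64 * pi * c / sqrt (lorentz a a) * (L1_norm (1/2) f)\<^sup>2)"
      by (simp add: K_def)
  qed
qed

end
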